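(* For every finite simple undirected graph $G=(V,E)$ there exist words $w,v\in V^\ast$ with $\mathrm{alph}(w)=\mathrm{alph}(v)=V$ such that $G(w,v)=G$.
   Context: Vertices of graphs are treated as letters of an alphabet. For a word $w$, $\mathrm{alph}(w)$ is the set of letters occurring in $w$. For letters $a,b$, the projection $\pi_{a,b}$ is the monoid morphism on words that maps $a\mapsto a$, $b\mapsto b$ and every other letter to the empty word. For words $w,v$ with $\mathrm{alph}(w)=\mathrm{alph}(v)=A$, $G(w,v)$ denotes the undirected simple graph with vertex set $A$ in which distinct $a,b\in A$ are adjacent if and only if $\pi_{a,b}(w)=\pi_{a,b}(v)$. *)

theory Defs
  imports "Graph_Theory.Pair_Digraph"
begin

definition proj :: "'a \<Rightarrow> 'a \<Rightarrow> 'a list \<Rightarrow> 'a list" where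
  "proj a b w = filter (\<lambda>c. c = a \<or> c = b) w"

lemma proj_Nil [simp]: "proj a b [] = []"
  by (simp add: proj_def)

lemma proj_append [simp]: "proj a b (u @ w) = proj a b u @ proj a b w"
  by (simp add: proj_def)

lemma proj_letter: "proj a b [c] = (if c = a \<or> c = b then [c] else [])"
  by (simp add: proj_def)

lemma proj_commute: "proj a b w = proj b a w"
  by (simp add: proj_def disj_commute)

(* Only meaningful when set w = set v, the common alphabet of the two words.
   An undirected edge between a and b is represented by the two arcs (a, b) and (b, a),
   as in the locale pair_graph of finite, symmetric, loop-free pair digraphs. *)
definition word_graph :: "'a list \<Rightarrow> 'a list \<Rightarrow> 'a pair_pre_digraph" where
  "word_graph w v =
    \<lparr> pverts = set w,
      parcs = {(a, b). a \<in> set w \<and> b \<in> set w \<and> a \<noteq> b \<and> proj a b w = proj a b v} \<rparr>"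

lemma pair_graph_word_graph: "pair_graph (word_graph w v)"
proof
  show "finite (parcs (word_graph w v))"
    by (rule finite_subset[of _ "set w \<times> set w"]) (auto simp: word_graph_def)
qed (auto simp: word_graph_def symmetric_def sym_def arcs_ends_def arc_to_ends_def proj_commute)

end

theory Submission
  imports Defs
begin

text \<open>
  Swapping two adjacent distinct letters \<open>c\<close>, \<open>d\<close> changes the projection to \<open>{c, d}\<close> and no other
  projection to a pair of distinct letters. Concatenate the words \<open>cd\<close> over all non-edges \<open>(c, d)\<close>
  to get one word, and the words \<open>dc\<close> in the same order to get the other. Corresponding factors
  have equal letter counts, so the projections agree iff they agree factor by factor. Appending an
  enumeration of the vertices to both words makes every vertex occur.
\<close>

definition pair_word :: "('a \<times> 'a) list \<Rightarrow> 'a list" where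
  "pair_word ps = concat (map (\<lambda>(c, d). [c, d]) ps)"

lemma pair_word_Nil [simp]: "pair_word [] = []"
  by (simp add: pair_word_def)

lemma pair_word_Cons [simp]: "pair_word ((c, d) # ps) = c # d # pair_word ps"
  by (simp add: pair_word_def)

lemma set_pair_word_subset:
  assumes "set ps \<subseteq> A \<times> A"
  shows "set (pair_word ps) \<subseteq> A"
  using assms by (auto simp: pair_word_def)

lemma proj_pair_word_swap_eq_iff:
  assumes "a \<noteq> b" and "\<forall>(c, d) \<in> set ps. c \<noteq> d"
  shows "proj a b (pair_word ps @ us) = proj a b (pair_word (map prod.swap ps) @ us)
    \<longleftrightarrow> (a, b) \<notin> set ps \<and> (b, a) \<notin> set ps"
  using assms(2)
proof (induction ps)
  case Nil
  show ?case by simp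
next
  case (Cons p ps)
  obtain c d where "p = (c, d)" by (cases p)
  \<comment> \<open>If \<open>{c, d} = {a, b}\<close>, the two projections differ in their first
    letter. Otherwise at most one of \<open>c\<close>, \<open>d\<close> survives, the same on both
    sides, and cancels.\<close>
  with Cons assms(1) show ?case by (auto simp: proj_def)
qed

theorem theorem1:
  fixes G :: "'a pair_pre_digraph"
  assumes "pair_graph G"
  shows "\<exists>w v :: 'a list. set w = pverts G \<and> set v = pverts G \<and> word_graph w v = G"
proof -
  interpret pair_graph G by (rule assms)
  \<comment> \<open>Both orientations of a non-edge lie in \<open>N\<close>; the factors
    \<open>cd\<close> and \<open>dc\<close> do not undo each other, since the first mismatch
    decides.\<close>
  define N where "N = {(a, b). a \<in> pverts G \<and> b \<in> pverts G \<and> a \<noteq> b \<and> (a, b) \<notin> parcs G}"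
  have "finite N"
    by (rule finite_subset[of _ "pverts G \<times> pverts G"]) (auto simp: N_def)
  then obtain ps where ps: "set ps = N"
    using finite_list by blast
  obtain us where us: "set us = pverts G"
    using finite_list[OF pair_finite_verts] by blast
  define w where "w = pair_word ps @ us"
  define v where "v = pair_word (map prod.swap ps) @ us"
  have w: "set w = pverts G"
    using set_pair_word_subset[of ps "pverts G"] us ps by (auto simp: w_def N_def)
  have v: "set v = pverts G"
  proof -
    have "set (map prod.swap ps) \<subseteq> pverts G \<times> pverts G"
      using ps by (auto simp: N_def)
    from set_pair_word_subset[OF this] us show ?thesis
      by (auto simp: v_def)
  qed
  have sym: "(b, a) \<in> parcs G" if "(a, b) \<in> parcs G" for a b
    using that by (rule arcs_symmetric)
  have "proj a b w = proj a b v \<longleftrightarrow> (a, b) \<in> parcs G"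
    if "a \<in> pverts G" "b \<in> pverts G" "a \<noteq> b" for a b
  proof -
    have "proj a b w = proj a b v \<longleftrightarrow> (a, b) \<notin> N \<and> (b, a) \<notin> N"
      unfolding w_def v_def ps[symmetric]
      by (rule proj_pair_word_swap_eq_iff) (use that ps in \<open>auto simp: N_def\<close>)
    with that sym show ?thesis by (auto simp: N_def)
  qed
  \<comment> \<open>The equivalence covers only distinct vertices; arcs of \<open>G\<close> join no
    others.\<close>
  moreover have "a \<in> pverts G \<and> b \<in> pverts G \<and> a \<noteq> b" if "(a, b) \<in> parcs G" for a b
    using that in_arcsD1 in_arcsD2 no_loops' by blast
  ultimately have "parcs (word_graph w v) = parcs G"
    unfolding word_graph_def by (auto simp: w)
  then have "word_graph w v = G"
    by (simp add: word_graph_def w)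
  with w v show ?thesis by blast
qed

end
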